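(* Let $x \geq 3$ and let $\gamma,\delta$ be real numbers with $0 < \gamma < \delta < \log 2$. Then the inequality \[ f(n) < n^{1 - (\log 2 - \delta)/\log \log n} \] holds for all integers $n \in [3, x]$ except for at most $O_\gamma\!\left(x^{1 - (\delta - \gamma)/\log \log x}\right)$ integers $n$ in $[3,x]$, where the implied constant depends only on $\gamma$.
   Context: A practical number is a positive integer $m$ such that every positive integer less than $m$ can be written as a sum of distinct divisors of $m$. For each positive integer $n$, $f(n)$ denotes the number of integers $k$ with $0 \leq k \leq n$ such that the binomial coefficient $\binom{n}{k}$ is not a practical number. *)

theory Defs
  imports Complex_Main
begin

definition practical :: "nat \<Rightarrow> bool" where
  "practical m \<longleftrightarrow> m > 0 \<and>
     (\<forall>j. 0 < j \<and> j < m \<longrightarrow> (\<exists>D \<subseteq> {d. d dvd m}. j = \<Sum>D))"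

definition nonpractical_binomials :: "nat \<Rightarrow> nat" where
  "nonpractical_binomials n = card {k. k \<le> n \<and> \<not> practical (n choose k)}"

end

theory Submission
  imports Defs "HOL-Computational_Algebra.Primes" "HOL-Analysis.Harmonic_Numbers" "HOL-Real_Asymp.Real_Asymp"
begin

text \<open>
  If the primorial of \<open>y\<close> is at least \<open>n\<close>, then a binomial coefficient \<open>n choose k\<close> divisible by all
  primes up to \<open>y\<close> is practical: build it up by multiplying in its prime powers in increasing order
  of the primes, each prime being at most one more than the product so far (by Euclid's argument
  for the primes up to \<open>y\<close>, and because all prime factors are at most \<open>n\<close> for the others). Central
  binomial coefficients show that \<open>y = (ln x)\<^sup>a\<close> with \<open>a > 1\<close> close to \<open>1\<close> suffices for all \<open>n \<le> x\<close>.
  By Kummer's theorem, the number \<open>N\<^sub>p n\<close> of \<open>k \<le> n\<close> with \<open>n choose k\<close> prime to \<open>p\<close> grows at most by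
  the factor \<open>d + 1\<close> when a base-\<open>p\<close> digit \<open>d\<close> is appended to \<open>n\<close>. On average over \<open>d\<close> this is
  \<open>(p + 1) / 2\<close>, so the sum of \<open>N\<^sub>p n / n\<close> over \<open>n \<le> x\<close> is about \<open>((p + 1) / 2)\<^sup>L\<close> with
  \<open>L = ln x / ln p\<close>, which is at most \<open>x\<close> to the power \<open>1 - (ln 2 - \<eta>) / ln (ln x)\<close> uniformly in
  \<open>p \<le> y\<close>. Summing over \<open>p\<close> and applying Markov's inequality gives the bound on the exceptions. The
  weight \<open>1 / n\<close> makes the argument insensitive to the dependence of the threshold on \<open>n\<close>.
\<close>

section \<open>Practical numbers\<close>

lemma practicalI:
  assumes "m > 0" "\<And>j. j < m \<Longrightarrow> \<exists>D \<subseteq> {d. d dvd m}. j = \<Sum>D"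
  shows "practical m"
  using assms by (auto simp: practical_def)

lemma practical_less_sum_divisors:
  assumes "practical m" "j < m"
  obtains D where "D \<subseteq> {d. d dvd m}" "j = \<Sum>D"
proof (cases "j = 0")
  case True
  then show ?thesis using that[of "{}"] by simp
next
  case False
  then show ?thesis using assms that by (auto simp: practical_def)
qed

lemma practical_le_sum_divisors:
  assumes "practical m" "j \<le> m"
  obtains D where "D \<subseteq> {d. d dvd m}" "j = \<Sum>D"
proof (cases "j = m")
  case True
  then show ?thesis using that[of "{m}"] by simp
next
  case False
  then show ?thesis using assms that practical_less_sum_divisors[of m j] by (metis le_neq_implies_less)
qed

text \<open>Divide \<open>j\<close> by \<open>p\<close> with remainder. By induction the quotient is
  a sum of distinct divisors of \<open>m * p ^ e\<close>, which are then multiplied by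
  \<open>p\<close>; the remainder is at most \<open>p - 1 \<le> m\<close>, so it is a sum of
  distinct divisors of \<open>m\<close>. The two sets are disjoint since \<open>p\<close> does not
  divide \<open>m\<close>.\<close>

lemma practical_mult_prime_power:
  assumes m: "practical m" and p: "prime p" and co: "\<not> p dvd m" and le: "p \<le> m + 1"
  shows "practical (m * p ^ e)"
proof (induction e)
  case 0
  then show ?case using m by simp
next
  case (Suc e)
  have m0: "m > 0" using m by (simp add: practical_def)
  have p0: "p > 0" using p by (simp add: prime_gt_0_nat)
  show ?case
  proof (rule practicalI)
    show "m * p ^ Suc e > 0" using m0 p0 by simp
    fix j assume j: "j < m * p ^ Suc e"
    have "j div p < m * p ^ e" using j p0 by (simp add: div_less_iff_less_mult mult_ac)
    then obtain A where A: "A \<subseteq> {d. d dvd m * p ^ e}" "j div p = \<Sum>A"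
      using practical_less_sum_divisors[OF Suc] by blast
    have "j mod p < p" using p0 by simp
    hence "j mod p \<le> m" using le by linarith
    then obtain B where B: "B \<subseteq> {d. d dvd m}" "j mod p = \<Sum>B"
      using practical_le_sum_divisors[OF m] by blast
    have "A \<subseteq> {..m * p ^ e}" using A(1) m0 p0 by (auto intro: dvd_imp_le)
    hence fA: "finite A" by (rule finite_subset) simp
    have "B \<subseteq> {..m}" using B(1) m0 by (auto intro: dvd_imp_le)
    hence fB: "finite B" by (rule finite_subset) simp
    have disj: "(*) p ` A \<inter> B = {}" using B(1) co by (auto dest: dvd_mult_left)
    have "\<Sum>((*) p ` A \<union> B) = \<Sum>((*) p ` A) + \<Sum>B"
      using fA fB disj by (intro sum.union_disjoint) auto
    also have "\<Sum>((*) p ` A) = p * \<Sum>A"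
      using p0 by (subst sum.reindex) (auto simp: inj_on_def sum_distrib_left)
    also have "p * \<Sum>A + \<Sum>B = j" using A(2) B(2) by (metis mult_div_mod_eq)
    finally have "j = \<Sum>((*) p ` A \<union> B)" ..
    moreover have "(*) p ` A \<union> B \<subseteq> {d. d dvd m * p ^ Suc e}"
      using A(1) B(1) by (auto simp: mult.left_commute[of m p] intro: mult_dvd_mono)
    ultimately show "\<exists>D \<subseteq> {d. d dvd m * p ^ Suc e}. j = \<Sum>D" by blast
  qed
qed

section \<open>A criterion for practicality through smooth parts\<close>

definition primorial_below :: "nat \<Rightarrow> nat" where
  "primorial_below t = \<Prod>{q. prime q \<and> q < t}"

text \<open>The bound \<open>q < t\<close> is strict so that \<open>smooth_part p n\<close> is the
  product accumulated just before the prime \<open>p\<close> is multiplied in.\<close>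

definition smooth_part :: "nat \<Rightarrow> nat \<Rightarrow> nat" where
  "smooth_part t n = (\<Prod>q | prime q \<and> q < t. q ^ multiplicity q n)"

lemma smooth_part_Suc:
  "smooth_part (Suc t) n = (if prime t then smooth_part t n * t ^ multiplicity t n else smooth_part t n)"
proof -
  have "{q. prime q \<and> q < Suc t} = (if prime t then insert t {q. prime q \<and> q < t} else {q. prime q \<and> q < t})"
    by (auto simp: less_Suc_eq)
  thus ?thesis by (simp add: smooth_part_def mult.commute)
qed

lemma not_dvd_smooth_part:
  assumes "prime p" "t \<le> p"
  shows "\<not> p dvd smooth_part t n"
proof
  assume "p dvd smooth_part t n"
  then obtain q where q: "prime q" "q < t" "p dvd q ^ multiplicity q n"
    using assms(1) by (auto simp: smooth_part_def prime_dvd_prod_iff)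
  hence "p dvd q" using prime_dvd_power[OF assms(1)] by blast
  hence "p = q" using primes_dvd_imp_eq[OF assms(1) q(1)] by blast
  thus False using q(2) assms(2) by simp
qed

lemma smooth_part_eq_self:
  assumes "n > 0" "\<And>p. prime p \<Longrightarrow> p dvd n \<Longrightarrow> p < t"
  shows "smooth_part t n = n"
proof -
  have "smooth_part t n = (\<Prod>q\<in>prime_factors n. q ^ multiplicity q n)"
    unfolding smooth_part_def using assms
    by (intro prod.mono_neutral_right) (auto simp: prime_factors_dvd not_dvd_imp_multiplicity_0)
  thus ?thesis using prime_factorization_nat[of n] assms by simp
qed

text \<open>A weak form of the sufficient half of the Stewart-Sierpinski criterion: the product of
  the smaller prime powers stands in for its sum of divisors. The induction over \<open>t\<close>
  multiplies in the full power of each prime factor in turn.\<close>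

lemma practical_criterion:
  assumes n: "n > 0" and le: "\<And>p. prime p \<Longrightarrow> p dvd n \<Longrightarrow> p \<le> smooth_part p n + 1"
  shows "practical n"
proof -
  have "practical (smooth_part t n)" for t
  proof (induction t)
    case 0
    then show ?case by (auto simp: smooth_part_def practical_def)
  next
    case (Suc t)
    show ?case
    proof (cases "prime t \<and> t dvd n")
      case True
      then show ?thesis using Suc le[of t] not_dvd_smooth_part[of t t n]
        by (auto simp: smooth_part_Suc intro: practical_mult_prime_power)
    next
      case False
      then show ?thesis using Suc by (auto simp: smooth_part_Suc not_dvd_imp_multiplicity_0)
    qed
  qed
  moreover have "smooth_part (Suc n) n = n"
    using n by (intro smooth_part_eq_self) (auto simp: less_Suc_eq_le dvd_imp_le)
  ultimately show ?thesis by metis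
qed

text \<open>Euclid's argument: a prime factor of the primorial plus one is at least \<open>p\<close>.\<close>

lemma prime_le_primorial:
  assumes "prime p"
  shows "p \<le> primorial_below p + 1"
proof -
  have "primorial_below p > 0"
    unfolding primorial_below_def by (intro prod_pos) (auto simp: prime_gt_0_nat)
  then obtain r where r: "prime r" "r dvd primorial_below p + 1"
    using prime_factor_nat[of "primorial_below p + 1"] by auto
  have "\<not> r < p"
  proof
    assume "r < p"
    hence "r dvd primorial_below p" unfolding primorial_below_def using r(1) by (intro dvd_prodI) auto
    hence "r dvd 1" using r(2) by (metis dvd_add_right_iff)
    thus False using r(1) by simp
  qed
  moreover have "r \<le> primorial_below p + 1" using r(2) by (intro dvd_imp_le) auto
  ultimately show ?thesis by linarith
qed

lemma primorial_le_smooth_part: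
  assumes "n > 0" "\<And>q. prime q \<Longrightarrow> q < t \<Longrightarrow> q dvd n"
  shows "primorial_below t \<le> smooth_part t n"
  unfolding primorial_below_def smooth_part_def
proof (intro prod_mono conjI)
  fix q assume "q \<in> {q. prime q \<and> q < t}"
  hence q: "prime q" "q < t" by auto
  hence "multiplicity q n \<ge> 1" using assms by (intro multiplicity_geI) auto
  hence "q ^ 1 \<le> q ^ multiplicity q n" using q prime_ge_1_nat by (intro power_increasing) auto
  thus "q \<le> q ^ multiplicity q n" by simp
qed simp

lemma smooth_part_mono:
  assumes "s \<le> t"
  shows "smooth_part s n \<le> smooth_part t n"
  unfolding smooth_part_def using assms
  by (intro dvd_imp_le prod_dvd_prod_subset prod_pos) (auto simp: prime_gt_0_nat)

section \<open>Reduction to binomial coefficients prime to a small prime\<close>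

lemma practical_binomial:
  assumes k: "k \<le> n" and y: "n \<le> primorial_below y"
    and dvd: "\<And>q. prime q \<Longrightarrow> q < y \<Longrightarrow> q dvd (n choose k)"
  shows "practical (n choose k)"
proof (rule practical_criterion)
  show pos: "n choose k > 0" using k by simp
  fix p assume p: "prime p" "p dvd (n choose k)"
  show "p \<le> smooth_part p (n choose k) + 1"
  proof (cases "p < y")
    case True
    hence "primorial_below p \<le> smooth_part p (n choose k)"
      using pos dvd by (intro primorial_le_smooth_part) auto
    with prime_le_primorial[OF p(1)] show ?thesis by linarith
  next
    case False
    \<comment> \<open>For a prime factor \<open>p \<ge> y\<close> no Euclid argument is needed: it
      is at most \<open>n\<close>, and the \<open>y\<close>-smooth part is already at least
      \<open>n\<close>.\<close>
    have "(n choose k) dvd fact n"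
      by (metis binomial_fact_lemma k dvd_triv_right)
    hence "p \<le> n" using p prime_dvd_fact_iff dvd_trans by blast
    also have "n \<le> primorial_below y" by fact
    also have "\<dots> \<le> smooth_part y (n choose k)"
      using pos dvd by (intro primorial_le_smooth_part) auto
    also have "\<dots> \<le> smooth_part p (n choose k)"
      using False by (intro smooth_part_mono) auto
    finally show ?thesis by simp
  qed
qed

definition coprime_binomials :: "nat \<Rightarrow> nat \<Rightarrow> nat" where
  "coprime_binomials p n = card {k. k \<le> n \<and> \<not> p dvd (n choose k)}"

text \<open>Union bound: a non-practical \<open>n choose k\<close> must miss some prime below
  \<open>y\<close>.\<close>

lemma nonpractical_binomials_le:
  assumes "n \<le> primorial_below y"
  shows "nonpractical_binomials n \<le> (\<Sum>p | prime p \<and> p < y. coprime_binomials p n)"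
proof -
  have "{k. k \<le> n \<and> \<not> practical (n choose k)}
      \<subseteq> (\<Union>p\<in>{p. prime p \<and> p < y}. {k. k \<le> n \<and> \<not> p dvd (n choose k)})"
    using practical_binomial[OF _ assms] by blast
  hence "nonpractical_binomials n
      \<le> card (\<Union>p\<in>{p. prime p \<and> p < y}. {k. k \<le> n \<and> \<not> p dvd (n choose k)})"
    unfolding nonpractical_binomials_def by (intro card_mono) auto
  also have "\<dots> \<le> (\<Sum>p | prime p \<and> p < y. coprime_binomials p n)"
    unfolding coprime_binomials_def by (intro card_UN_le) auto
  finally show ?thesis .
qed

section \<open>Binomial coefficients not divisible by a prime\<close>

lemma multiplicity_fact_rec:
  fixes p :: nat
  assumes p: "prime p"
  shows "multiplicity p (fact n) = n div p + multiplicity p (fact (n div p) :: nat)"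
proof (induction n)
  case 0
  then show ?case by simp
next
  case (Suc n)
  have F: "multiplicity p (fact (Suc m)) = multiplicity p (Suc m) + multiplicity p (fact m)" for m
    using p by (simp add: prime_elem_multiplicity_mult_distrib del: mult_Suc of_nat_Suc)
  show ?case
  proof (cases "p dvd Suc n")
    case True
    then obtain c where c: "Suc n = p * c" by blast
    have p0: "p > 0" using p by (simp add: prime_gt_0_nat)
    then obtain b where b: "c = Suc b" using c by (cases c) auto
    have 1: "Suc n div p = Suc b" using c b p0 by simp
    have 2: "n div p = b" using 1 True by (simp add: div_Suc dvd_eq_mod_eq_0)
    have "multiplicity p (Suc n) = Suc (multiplicity p (Suc b))"
      unfolding c b using p by (intro multiplicity_times_same) (auto simp: prime_gt_0_nat)
    then show ?thesis using Suc F[of n] F[of b] by (simp add: 1 2 del: fact_Suc)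
  next
    case False
    hence "Suc n div p = n div p" by (simp add: div_Suc dvd_eq_mod_eq_0)
    then show ?thesis using Suc F[of n] False by (simp add: not_dvd_imp_multiplicity_0 del: fact_Suc)
  qed
qed

text \<open>Legendre's formula, by iterating the one-step recursion. The sum may stop at
  \<open>M\<close> because \<open>n < p ^ Suc M\<close> makes all later terms zero.\<close>

lemma multiplicity_fact:
  fixes p :: nat
  assumes p: "prime p" and n: "n < p ^ Suc M"
  shows "multiplicity p (fact n :: nat) = (\<Sum>i=1..M. n div p ^ i)"
  using n
proof (induction M arbitrary: n)
  case 0
  then show ?case using p by (simp add: multiplicity_fact_rec[OF p, of n])
next
  case (Suc M)
  have "n div p < p ^ Suc M" using Suc.prems p
    by (simp add: div_less_iff_less_mult prime_gt_0_nat mult_ac)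
  from Suc.IH[OF this] have "multiplicity p (fact (n div p) :: nat) = (\<Sum>i=1..M. n div p ^ Suc i)"
    by (simp add: div_mult2_eq)
  also have "\<dots> = (\<Sum>i=2..Suc M. n div p ^ i)"
    using sum.shift_bounds_cl_Suc_ivl[of "\<lambda>i. n div p ^ i" 1 M] by (simp add: numeral_2_eq_2)
  finally have "multiplicity p (fact n :: nat) = n div p + (\<Sum>i=2..Suc M. n div p ^ i)"
    using multiplicity_fact_rec[OF p, of n] by simp
  also have "\<dots> = (\<Sum>i=1..Suc M. n div p ^ i)"
    by (subst sum.atLeast_Suc_atMost[of 1]) (auto simp: numeral_2_eq_2)
  finally show ?case .
qed

lemma multiplicity_binomial:
  fixes p :: nat
  assumes "prime p" "k \<le> n"
  shows "multiplicity p (fact n :: nat) =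
    multiplicity p (fact k :: nat) + multiplicity p (fact (n - k) :: nat) + multiplicity p (n choose k)"
proof -
  have *: "multiplicity p (a * b * c) = multiplicity p a + multiplicity p b + multiplicity p c"
    if "a \<noteq> 0" "b \<noteq> 0" "c \<noteq> 0" for a b c :: nat
  proof -
    have "prime_elem p" using assms(1) by simp
    moreover have "a * b \<noteq> 0" using that by simp
    ultimately show ?thesis
      using that prime_elem_multiplicity_mult_distrib[of p "a * b" c]
        prime_elem_multiplicity_mult_distrib[of p a b] by linarith
  qed
  have "n choose k \<noteq> 0" using assms(2) by simp
  from *[OF fact_nonzero[of k] fact_nonzero[of "n - k"] this] show ?thesis
    unfolding binomial_fact_lemma[OF assms(2)] .
qed

lemma div_add_div_le: "(a::nat) div c + b div c \<le> (a + b) div c"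
  using div_add1_eq[of a b c] by linarith

text \<open>In Legendre's formula each of the \<open>M\<close> terms contributes at most one carry,
  so the multiplicity is at most \<open>M\<close>, where \<open>p ^ M \<le> n\<close>.\<close>

lemma prime_power_dvd_binomial_le:
  assumes p: "prime p" and n: "n > 0" "k \<le> n"
  shows "p ^ multiplicity p (n choose k) \<le> n"
proof -
  obtain M where M: "p ^ M \<le> n" "n < p ^ Suc M"
    using ex_power_ivl1[of p n] n p prime_ge_2_nat by (metis Suc_eq_plus1 Suc_leI One_nat_def)
  have less: "k < p ^ Suc M" "n - k < p ^ Suc M" using M(2) n by linarith+
  have le: "n div p ^ i \<le> k div p ^ i + (n - k) div p ^ i + 1" for i
  proof -
    have "n div p ^ i = (k + (n - k)) div p ^ i" using n by simp
    also have "\<dots> = k div p ^ i + (n - k) div p ^ i + (k mod p ^ i + (n - k) mod p ^ i) div p ^ i"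
      by (rule div_add1_eq)
    \<comment> \<open>Two remainders below \<open>p ^ i\<close> add up to less than twice
      \<open>p ^ i\<close>, so the carry is 0 or 1.\<close>
    also have "(k mod p ^ i + (n - k) mod p ^ i) div p ^ i < 2"
      using p by (intro div_less_iff_less_mult[THEN iffD2])
        (auto simp: prime_gt_0_nat mult_2 intro!: add_strict_mono)
    finally show ?thesis by linarith
  qed
  have "(\<Sum>i=1..M. n div p ^ i) \<le> (\<Sum>i=1..M. k div p ^ i + (n - k) div p ^ i + 1)"
    by (intro sum_mono le)
  hence "multiplicity p (fact n :: nat) \<le> multiplicity p (fact k :: nat) + multiplicity p (fact (n - k) :: nat) + M"
    unfolding multiplicity_fact[OF p M(2)] multiplicity_fact[OF p less(1)] multiplicity_fact[OF p less(2)]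
    by (simp add: sum.distrib sum_Suc)
  hence "multiplicity p (n choose k) \<le> M"
    using multiplicity_binomial[OF p n(2)] by linarith
  hence "p ^ multiplicity p (n choose k) \<le> p ^ M"
    using p by (intro power_increasing) (auto dest: prime_ge_1_nat)
  with M(1) show ?thesis by linarith
qed

lemma multiplicity_fact_superadditive:
  fixes p :: nat
  assumes "prime p"
  shows "multiplicity p (fact a :: nat) + multiplicity p (fact b :: nat) \<le> multiplicity p (fact (a + b) :: nat)"
  using multiplicity_binomial[OF assms, of a "a + b"] by simp

lemma multiplicity_fact_mono:
  fixes p :: nat
  assumes "prime p" "a \<le> b"
  shows "multiplicity p (fact a :: nat) \<le> multiplicity p (fact b :: nat)"
  using multiplicity_binomial[OF assms] by simp

text \<open>Adding \<open>k\<close> and \<open>n - k\<close> in base \<open>p\<close> produces no carry, because the summands of Legendre's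
  formula must match termwise.\<close>

lemma not_dvd_binomial:
  assumes p: "prime p" and k: "k \<le> n" and nd: "\<not> p dvd (n choose k)"
  shows "k mod p \<le> n mod p" "\<not> p dvd ((n div p) choose (k div p))"
proof -
  define v where "v = (\<lambda>m. multiplicity p (fact m :: nat))"
  have rec: "v m = m div p + v (m div p)" for m
    unfolding v_def by (rule multiplicity_fact_rec[OF p])
  have 0: "v n = v k + v (n - k)"
    using multiplicity_binomial[OF p k] nd by (simp add: v_def not_dvd_imp_multiplicity_0)
  have le: "k div p + (n - k) div p \<le> n div p"
    using div_add_div_le[of k p "n - k"] k by simp
  have "v (k div p) + v ((n - k) div p) \<le> v (k div p + (n - k) div p)"
    unfolding v_def by (rule multiplicity_fact_superadditive[OF p])
  also have "\<dots> \<le> v (n div p)" unfolding v_def using le by (rule multiplicity_fact_mono[OF p])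
  finally have eq: "n div p = k div p + (n - k) div p" "v (n div p) = v (k div p) + v ((n - k) div p)"
    using 0 le rec[of n] rec[of k] rec[of "n - k"] by linarith+
  have kd: "k div p \<le> n div p" using k by (rule div_le_mono)
  have "(n - k) div p = n div p - k div p" using eq(1) by simp
  hence "multiplicity p ((n div p) choose (k div p)) = 0"
    using multiplicity_binomial[OF p kd] eq(2) by (simp add: v_def)
  thus "\<not> p dvd ((n div p) choose (k div p))"
    using kd p prime_multiplicity_gt_zero_iff[of p "(n div p) choose (k div p)"] by simp
  have "n = p * (k div p) + p * ((n - k) div p) + n mod p"
    using mult_div_mod_eq[of p n] unfolding eq(1) distrib_left by simp
  moreover have "p * ((n - k) div p) \<le> n - k" by simp
  ultimately show "k mod p \<le> n mod p"
    using mult_div_mod_eq[of p k] k by linarith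
qed

section \<open>Counting by base-\<open>p\<close> digits\<close>

lemma coprime_binomials_rec:
  assumes p: "prime p" and a: "a < p"
  shows "coprime_binomials p (m * p + a) \<le> (a + 1) * coprime_binomials p m"
proof -
  let ?A = "{k. k \<le> m * p + a \<and> \<not> p dvd ((m * p + a) choose k)}"
  let ?B = "{..a} \<times> {k. k \<le> m \<and> \<not> p dvd (m choose k)}"
  have d: "(m * p + a) div p = m" "(m * p + a) mod p = a" using a by auto
  have "inj_on (\<lambda>k. (k mod p, k div p)) ?A"
    by (rule inj_onI) (metis Pair_inject mult_div_mod_eq)
  moreover have "(\<lambda>k. (k mod p, k div p)) ` ?A \<subseteq> ?B"
  proof (clarify, intro conjI SigmaI CollectI)
    fix k assume k: "k \<le> m * p + a" "\<not> p dvd ((m * p + a) choose k)"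
    show "k mod p \<in> {..a}" "\<not> p dvd (m choose (k div p))"
      using not_dvd_binomial[OF p k] d by auto
    show "k div p \<le> m" using div_le_mono[OF k(1), of p] d by simp
  qed
  ultimately have "card ?A \<le> card ?B" by (intro card_inj_on_le) auto
  thus ?thesis by (simp add: coprime_binomials_def card_cartesian_product)
qed

lemma coprime_binomials_le: "coprime_binomials p n \<le> n + 1"
proof -
  have "coprime_binomials p n \<le> card {..n}" unfolding coprime_binomials_def by (intro card_mono) auto
  thus ?thesis by simp
qed

text \<open>The term \<open>n = 0\<close> is \<open>1 / 0 = 0\<close>.\<close>

lemma sum_coprime_binomials:
  assumes p: "prime p"
  shows "(\<Sum>n<p ^ M. real (coprime_binomials p n) / real n) \<le> 2 * real p * real M * ((real p + 1) / 2) ^ M"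
proof (induction M)
  case 0
  then show ?case by simp
next
  case (Suc M)
  define h where "h = (\<lambda>n. real (coprime_binomials p n) / real n)"
  have p0: "p > 0" using p by (simp add: prime_gt_0_nat)
  have gauss: "(\<Sum>a<k. real a + 1) = real k * (real k + 1) / 2" for k
    by (induction k) (auto simp: field_simps)
  \<comment> \<open>Group the numbers by all digits but the last. For \<open>m > 0\<close> the
    factors \<open>a + 1\<close> average to \<open>(p + 1) / 2\<close>. The block
    \<open>m = 0\<close> needs its own bound, since there \<open>h m\<close> is zero by the division
    convention.\<close>
  have block: "(\<Sum>a<p. h (m * p + a)) \<le> (if m = 0 then 2 * real p else 0) + (real p + 1) / 2 * h m" for m
  proof (cases "m = 0")
    case True
    have "h a \<le> 2" for a
    proof (cases "a = 0")
      case False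
      have "real (coprime_binomials p a) \<le> real (a + 1)" using coprime_binomials_le by (rule of_nat_mono)
      also have "\<dots> \<le> 2 * real a" using False by simp
      finally show ?thesis using False by (simp add: h_def field_simps)
    qed (simp add: h_def)
    hence "(\<Sum>a<p. h a) \<le> (\<Sum>a<p. 2)" by (intro sum_mono)
    thus ?thesis using True by (simp add: h_def mult.commute)
  next
    case False
    have "h (m * p + a) \<le> (real a + 1) * (h m / real p)" if "a < p" for a
    proof -
      have "real (coprime_binomials p (m * p + a)) \<le> real ((a + 1) * coprime_binomials p m)"
        using coprime_binomials_rec[OF p that] by (rule of_nat_mono)
      also have "\<dots> = (real a + 1) * real (coprime_binomials p m)" by (simp add: algebra_simps)
      finally have "h (m * p + a) \<le> (real a + 1) * real (coprime_binomials p m) / real (m * p)"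
        unfolding h_def using False p0 by (intro frac_le) auto
      thus ?thesis by (simp add: h_def)
    qed
    hence "(\<Sum>a<p. h (m * p + a)) \<le> (\<Sum>a<p. (real a + 1) * (h m / real p))" by (intro sum_mono) auto
    also have "\<dots> = (real p + 1) / 2 * h m" unfolding sum_distrib_right[symmetric] gauss using p0 by simp
    finally show ?thesis using False by simp
  qed
  have "(\<Sum>n<p ^ Suc M. h n) = (\<Sum>m<p ^ M. \<Sum>a<p. h (m * p + a))"
  proof -
    have "(\<Sum>n\<in>{m * p..<m * p + p}. h n) = (\<Sum>a<p. h (m * p + a))" for m
      using sum.shift_bounds_nat_ivl[of h 0 "m * p" p] by (simp add: add.commute lessThan_atLeast0)
    thus ?thesis using sum.nat_group[of h p "p ^ M"] by (simp add: mult.commute)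
  qed
  also have "\<dots> \<le> (\<Sum>m<p ^ M. (if m = 0 then 2 * real p else 0) + (real p + 1) / 2 * h m)"
    by (intro sum_mono block)
  also have "\<dots> = 2 * real p + (real p + 1) / 2 * (\<Sum>m<p ^ M. h m)"
    using p0 by (simp add: sum.distrib sum_distrib_left sum.delta)
  \<comment> \<open>The additive \<open>2 * p\<close> is inflated to a full extra term; these terms
    accumulate to the factor \<open>M\<close> in the bound.\<close>
  also have "\<dots> \<le> 2 * real p * ((real p + 1) / 2) ^ Suc M
      + (real p + 1) / 2 * (2 * real p * real M * ((real p + 1) / 2) ^ M)"
  proof (intro add_mono mult_left_mono)
    have "1 \<le> ((real p + 1) / 2) ^ Suc M" using p0 by (intro one_le_power) simp
    thus "2 * real p \<le> 2 * real p * ((real p + 1) / 2) ^ Suc M"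
      using mult_left_mono[of 1 _ "2 * real p"] p0 by (simp del: power_Suc)
  qed (use Suc in \<open>simp_all add: h_def\<close>)
  also have "\<dots> = 2 * real p * real (Suc M) * ((real p + 1) / 2) ^ Suc M"
  proof -
    have "2 * real p * (t * q) + t * (2 * real p * real M * q) = 2 * real p * real (Suc M) * (t * q)" for t q
      by (simp add: algebra_simps)
    thus ?thesis unfolding power_Suc by blast
  qed
  finally show ?case by (simp add: h_def)
qed

section \<open>Primorials\<close>

text \<open>This loses a logarithmic factor in the exponent, which the choice \<open>a > 1\<close>
  absorbs later.\<close>

lemma primorial_below_ge_power_card: "2 ^ card {q. prime q \<and> q < t} \<le> primorial_below t"
proof -
  have "(\<Prod>q | prime q \<and> q < t. 2) \<le> (\<Prod>q | prime q \<and> q < t. q)"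
    by (intro prod_mono) (auto simp: prime_ge_2_nat)
  thus ?thesis by (simp add: primorial_below_def)
qed

lemma central_binomial_le_power_card:
  assumes "m > 0"
  shows "(2 * m) choose m \<le> (2 * m) ^ card {q. prime q \<and> q < Suc (2 * m)}"
proof -
  let ?N = "(2 * m) choose m"
  have "?N dvd fact (2 * m)"
    using binomial_fact_lemma[of m "2 * m"] by (metis dvd_triv_right le_add2 mult_2)
  hence "p < Suc (2 * m)" if "prime p" "p dvd ?N" for p
    using that prime_dvd_fact_iff[of p "2 * m"] dvd_trans by (metis less_Suc_eq_le)
  hence "?N = smooth_part (Suc (2 * m)) ?N"
    by (intro smooth_part_eq_self[symmetric]) auto
  also have "\<dots> \<le> (\<Prod>q | prime q \<and> q < Suc (2 * m). 2 * m)"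
    unfolding smooth_part_def using assms
    by (intro prod_mono) (auto intro!: prime_power_dvd_binomial_le)
  finally show ?thesis by simp
qed

text \<open>Chebyshev's lower bound for the number \<open>c\<close> of primes: comparing
  \<open>4 ^ m / (2 * m)\<close> with \<open>(2 * m) ^ c\<close> through the central binomial
  coefficient. The denominator \<open>2 * m\<close> costs the \<open>- 1\<close>.\<close>

lemma ln_primorial_ge:
  assumes "m > 0"
  shows "ln 2 * (real m * ln 4 / ln (2 * real m) - 1) \<le> ln (real (primorial_below (Suc (2 * m))))"
proof -
  define c where "c = card {q. prime q \<and> q < Suc (2 * m)}"
  have "4 ^ m / (2 * real m) \<le> real ((2 * m) choose m)"
    using central_binomial_lower_bound[OF assms] by simp
  also have "\<dots> \<le> real ((2 * m) ^ c)"
    unfolding c_def by (intro of_nat_mono central_binomial_le_power_card assms)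
  finally have "4 ^ m \<le> real ((2 * m) ^ c) * (2 * real m)"
    using assms by (simp only: pos_divide_le_eq)
  hence "4 ^ m \<le> (2 * real m) ^ Suc c" by (simp add: mult.commute)
  hence "ln (4 ^ m) \<le> ln ((2 * real m) ^ Suc c)" by (rule ln_mono) simp
  hence "real m * ln 4 \<le> real (Suc c) * ln (2 * real m)"
    unfolding ln_realpow using assms by (simp add: algebra_simps)
  moreover have "ln (2 * real m) > 0" using assms by simp
  ultimately have "real m * ln 4 / ln (2 * real m) \<le> real (Suc c)"
    by (simp only: pos_divide_le_eq)
  hence "ln 2 * (real m * ln 4 / ln (2 * real m) - 1) \<le> ln 2 * real c"
    by (intro mult_left_mono) auto
  also have "\<dots> = ln (2 ^ c)" by (simp add: ln_realpow mult.commute)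
  also have "\<dots> \<le> ln (real (primorial_below (Suc (2 * m))))"
  proof (rule ln_mono)
    have "real (2 ^ c) \<le> real (primorial_below (Suc (2 * m)))"
      unfolding c_def by (intro of_nat_mono primorial_below_ge_power_card)
    thus "(2::real) ^ c \<le> real (primorial_below (Suc (2 * m)))" by simp
  qed simp
  finally show ?thesis .
qed

section \<open>Asymptotics\<close>

text \<open>Follows from \<open>ln t \<le> t - 1\<close> at \<open>t = v / u\<close>, with
  \<open>ln u \<ge> 1\<close>. It is applied to \<open>u = ln n\<close>, where it says that
  \<open>n powr (1 / ln (ln n))\<close> increases.\<close>

lemma ln_div_ln_ln_mono:
  fixes u v :: real
  assumes "exp 1 \<le> u" "u \<le> v"
  shows "u / ln u \<le> v / ln v"
proof -
  have u0: "u > 0" using assms(1) exp_gt_zero[of "1::real"] by linarith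
  have v0: "v > 0" using u0 assms by linarith
  have lu: "ln u \<ge> 1" using assms(1) u0 by (simp add: ln_ge_iff)
  have "ln u \<le> ln v" using u0 assms by simp
  hence lv: "ln v \<ge> 1" using lu by linarith
  have "ln (v / u) \<le> v / u - 1" using u0 v0 by (intro ln_le_minus_one) simp
  hence "u * (ln v - ln u) \<le> v - u"
    using u0 v0 by (simp add: ln_div field_simps)
  also have "v - u \<le> (v - u) * ln u" using mult_left_mono[OF lu, of "v - u"] assms by simp
  finally have "u * ln v \<le> v * ln u" by (simp add: algebra_simps)
  thus ?thesis using lu lv by (simp add: field_simps)
qed

text \<open>After taking logarithms, \<open>key\<close> compares the saving per unit of
  \<open>ln p\<close> with \<open>(ln 2 - \<eta>) / l\<close>. For large \<open>p\<close> the error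
  \<open>ln (1 + 1 / p)\<close> is at most \<open>\<eta> / 2\<close>, and the relation between
  \<open>a\<close> and \<open>\<eta>\<close> pays for \<open>ln p \<le> a * l\<close>. For bounded
  \<open>p\<close> the saving has a fixed positive lower bound, while
  \<open>(ln 2 - \<eta>) / l\<close> tends to 0.\<close>

lemma eventually_power_bound:
  fixes \<eta> a :: real
  assumes \<eta>: "0 < \<eta>" "\<eta> < ln 2" and a: "a * (ln 2 - \<eta>) = ln 2 - \<eta> / 2" "a > 0"
  shows "eventually (\<lambda>x. \<forall>p L. 2 \<le> p \<and> real p \<le> ln x powr a \<and> real p ^ L \<le> x \<longrightarrow>
    ((real p + 1) / 2) ^ L \<le> x powr (1 - (ln 2 - \<eta>) / ln (ln x))) at_top"
proof -
  have "eventually (\<lambda>x::real. x > exp 1) at_top" by (rule eventually_gt_at_top)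
  moreover have "eventually (\<lambda>x::real. ln (ln x) \<ge> 1) at_top" by real_asymp
  moreover have "filterlim (\<lambda>x::real. ln (ln x)) at_top at_top" by real_asymp
  \<comment> \<open>This threshold serves the primes below \<open>2 / \<eta>\<close>;
    \<open>4 / 3\<close> is \<open>2 / (1 + 1 / p)\<close> at \<open>p = 2\<close>.\<close>
  hence "eventually (\<lambda>x::real. ln (ln x) \<ge> ln 2 * ln (2 / \<eta>) / ln (4 / 3)) at_top"
    by (simp add: filterlim_at_top)
  ultimately show ?thesis
  proof eventually_elim
    case (elim x)
    define l where "l = ln (ln x)"
    have l: "l \<ge> 1" "l \<ge> ln 2 * ln (2 / \<eta>) / ln (4 / 3)" using elim by (auto simp: l_def)
    have x0: "x > 0" using elim(1) exp_gt_zero[of "1::real"] by linarith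
    have lx: "ln x > 1" using elim(1) x0 by (metis exp_gt_zero ln_exp ln_less_cancel_iff)
    have "ln 2 \<le> (1::real)" using ln_2_less_1 by simp
    hence E0: "1 - (ln 2 - \<eta>) / l \<ge> 0" using l(1) \<eta> by (simp add: field_simps)
    show ?case
    proof (intro allI impI, elim conjE)
      fix p L :: nat
      assume p: "2 \<le> p" "real p \<le> ln x powr a" and L: "real p ^ L \<le> x"
      have lp: "ln (real p) > 0" using p(1) by simp
      have key: "(ln 2 - \<eta>) / l \<le> (ln 2 - ln (1 + 1 / real p)) / ln (real p)"
      proof (cases "real p \<ge> 2 / \<eta>")
        case True
        have "1 / real p \<le> \<eta> / 2" using True \<eta>(1) p(1) by (simp add: field_simps)
        moreover have "ln (1 + 1 / real p) \<le> 1 / real p" by (rule ln_add_one_self_le_self) simp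
        ultimately have 1: "ln 2 - \<eta> / 2 \<le> ln 2 - ln (1 + 1 / real p)" by linarith
        have "ln (real p) \<le> ln (ln x powr a)" using p by (intro ln_mono) auto
        hence 2: "ln (real p) \<le> a * l" using lx by (simp add: l_def ln_powr)
        have "(ln 2 - \<eta>) / l = (ln 2 - \<eta> / 2) / (a * l)"
          unfolding a(1)[symmetric] using a(2) by simp
        also have "\<dots> \<le> (ln 2 - ln (1 + 1 / real p)) / ln (real p)"
          using 1 2 lp \<eta> by (intro frac_le) auto
        finally show ?thesis .
      next
        case False
        have 1: "ln (1 + 1 / real p) \<le> ln (3 / 2)" using p(1) by (intro ln_mono) (auto simp: field_simps)
        have "ln (2 / (3 / 2)) = ln 2 - ln (3 / 2 :: real)" by (subst ln_div) auto
        hence 2: "ln (4 / 3) \<le> ln 2 - ln (1 + 1 / real p)" using 1 by simp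
        have 3: "ln (real p) \<le> ln (2 / \<eta>)" using False p(1) by (intro ln_mono) auto
        hence 4: "ln (2 / \<eta>) > 0" using lp by linarith
        have 5: "ln (4 / 3 :: real) > 0" by simp
        have "(ln 2 - \<eta>) / l \<le> ln 2 / l" using l(1) \<eta> by (intro divide_right_mono) auto
        also have "\<dots> \<le> ln (4 / 3) / ln (2 / \<eta>)"
          using l 4 5 by (simp add: field_simps)
        also have "\<dots> \<le> (ln 2 - ln (1 + 1 / real p)) / ln (real p)"
        proof (rule frac_le)
          show "0 \<le> ln 2 - ln (1 + 1 / real p)" using 2 5 by linarith
        qed (use 2 3 lp in auto)
        finally show ?thesis .
      qed
      have "ln (real p + 1) = ln (real p * (1 + 1 / real p))" using p(1) by (simp add: distrib_left)
      also have "\<dots> = ln (real p) + ln (1 + 1 / real p)" using p(1) by (intro ln_mult_pos) (auto simp: add_pos_pos)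
      finally have "ln ((real p + 1) / 2) = ln (real p) + ln (1 + 1 / real p) - ln 2" by (simp add: ln_div)
      also have "\<dots> \<le> ln (real p) * (1 - (ln 2 - \<eta>) / l)"
      proof -
        have "(ln 2 - \<eta>) / l * ln (real p) \<le> ln 2 - ln (1 + 1 / real p)"
          using key lp by (simp only: pos_le_divide_eq)
        thus ?thesis by (simp add: algebra_simps)
      qed
      finally have 1: "ln ((real p + 1) / 2) \<le> ln (real p) * (1 - (ln 2 - \<eta>) / l)" .
      have "ln (real p ^ L) \<le> ln x" using L p(1) by (intro ln_mono) auto
      hence 2: "real L * ln (real p) \<le> ln x" using p(1) by (simp add: ln_realpow)
      have "((real p + 1) / 2) ^ L = exp (real L * ln ((real p + 1) / 2))"
        by (simp add: exp_of_nat_mult add_pos_pos)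
      also have "real L * ln ((real p + 1) / 2) \<le> real L * (ln (real p) * (1 - (ln 2 - \<eta>) / l))"
        using 1 by (intro mult_left_mono) auto
      also have "\<dots> \<le> ln x * (1 - (ln 2 - \<eta>) / l)"
        using mult_right_mono[OF 2 E0] by (simp add: mult.assoc)
      finally show "((real p + 1) / 2) ^ L \<le> x powr (1 - (ln 2 - \<eta>) / ln (ln x))"
        using x0 by (simp add: powr_def l_def mult.commute)
    qed
  qed
qed

lemma eventually_primorial_ge:
  fixes a :: real
  assumes a: "a > 1"
  shows "eventually (\<lambda>x. \<exists>m. 2 * real m \<le> ln x powr a \<and> x \<le> real (primorial_below (Suc (2 * m)))) at_top"
proof -
  have "eventually (\<lambda>x::real. x > 1) at_top" by (rule eventually_gt_at_top)
  moreover have "eventually (\<lambda>x::real. ln x > 1) at_top" by real_asymp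
  moreover have "eventually (\<lambda>x::real. ln x powr a \<ge> 4) at_top" using a by real_asymp
  \<comment> \<open>The right side has order \<open>(ln x) powr a / ln (ln x)\<close>, which
    dominates \<open>ln x\<close> because \<open>a > 1\<close>.\<close>
  moreover have "eventually (\<lambda>x. ln x \<le> ln 2 * ((ln x powr a / 2 - 1) * ln 4 / (a * ln (ln x)) - 1)) at_top"
    using a by real_asymp
  ultimately show ?thesis
  proof eventually_elim
    case (elim x)
    define m where "m = nat \<lfloor>ln x powr a / 2\<rfloor>"
    have m: "real m \<le> ln x powr a / 2" "real m > ln x powr a / 2 - 1"
      unfolding m_def using elim by linarith+
    hence m1: "real m > 1 - 1 / 2" using elim by linarith
    hence m0: "m > 0" by (cases m) auto
    have "ln (2 * real m) \<le> ln (ln x powr a)" using m(1) m0 by (intro ln_mono) auto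
    also have "\<dots> = a * ln (ln x)" using elim by (simp add: ln_powr)
    finally have 1: "ln (2 * real m) \<le> a * ln (ln x)" .
    have "ln x \<le> ln 2 * ((ln x powr a / 2 - 1) * ln 4 / (a * ln (ln x)) - 1)" by (rule elim)
    also have "\<dots> \<le> ln 2 * (real m * ln 4 / ln (2 * real m) - 1)"
      using 1 m m0 elim(3) by (intro mult_left_mono diff_right_mono frac_le mult_right_mono) auto
    also have "\<dots> \<le> ln (real (primorial_below (Suc (2 * m))))" by (rule ln_primorial_ge[OF m0])
    finally have "ln x \<le> ln (real (primorial_below (Suc (2 * m))))" .
    moreover have "real (primorial_below (Suc (2 * m))) > 0"
      by (auto simp: primorial_below_def intro!: prod_pos dest: prime_gt_0_nat)
    ultimately have "x \<le> real (primorial_below (Suc (2 * m)))"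
      using elim(1) by (subst (asm) ln_le_cancel_iff) auto
    thus ?case using m(1) by (intro exI[of _ m]) auto
  qed
qed

section \<open>The averaged bound and the exceptional set\<close>

text \<open>One \<open>\<eta>\<close> is spent in the power bound, the other on powers of
  \<open>ln x\<close>, all of which are eventually below
  \<open>x powr (\<eta> / ln (ln x))\<close>.\<close>

lemma eventually_sum_nonpractical_binomials:
  fixes \<eta> :: real
  assumes \<eta>: "0 < \<eta>" "\<eta> < ln 2"
  shows "eventually (\<lambda>x. (\<Sum>n | real n \<le> x. real (nonpractical_binomials n) / real n)
    \<le> x powr (1 - (ln 2 - 2 * \<eta>) / ln (ln x))) at_top"
proof -
  define a where "a = (ln 2 - \<eta> / 2) / (ln 2 - \<eta>)"
  have a: "a * (ln 2 - \<eta>) = ln 2 - \<eta> / 2" "a > 1" using \<eta> by (simp_all add: a_def)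
  have a0: "a > 0" using a by simp
  have "eventually (\<lambda>x::real. x > 1) at_top" by (rule eventually_gt_at_top)
  \<comment> \<open>The factors bound, in order, the number of primes, \<open>2 * p\<close>, the
    digit count \<open>Suc L\<close>, and the surplus \<open>(p + 1) / 2\<close>.\<close>
  moreover have "eventually (\<lambda>x. ln x powr a * (2 * (ln x powr a) * (2 * ln x + 1) * ln x powr a)
      \<le> x powr (\<eta> / ln (ln x))) at_top"
    using \<eta>(1) a by real_asymp
  ultimately show ?thesis
    using eventually_primorial_ge[OF a(2)] eventually_power_bound[OF \<eta> a(1) a0]
  proof eventually_elim
    case (elim x)
    define Y where "Y = ln x powr a"
    define E where "E = 1 - (ln 2 - \<eta>) / ln (ln x)"
    obtain m where m: "2 * real m \<le> Y" "x \<le> real (primorial_below (Suc (2 * m)))"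
      using elim(3) by (auto simp: Y_def)
    define P where "P = {p. prime p \<and> p < Suc (2 * m)}"
    have finP: "finite P" by (simp add: P_def)
    have "P \<subseteq> {1..2 * m}" by (auto simp: P_def dest: prime_ge_1_nat)
    hence "card P \<le> card {1..2 * m}" by (intro card_mono) auto
    hence cardP: "real (card P) \<le> Y" using m(1) by simp
    have fin: "finite {n. real n \<le> x}" by (rule finite_subset[of _ "{..nat \<lfloor>x\<rfloor>}"]) (auto simp: le_nat_floor)
    have bound: "(\<Sum>n | real n \<le> x. real (coprime_binomials p n) / real n)
        \<le> 2 * Y * (2 * ln x + 1) * Y * x powr E" if "p \<in> P" for p
    proof -
      have p: "prime p" "p \<ge> 2" "real p \<le> Y"
        using that m(1) by (auto simp: P_def prime_ge_2_nat)
      have "nat \<lfloor>x\<rfloor> \<ge> 1" using elim(1) by (simp add: le_nat_floor)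
      \<comment> \<open>The sum must run up to \<open>p ^ Suc L\<close> to cover all
        \<open>n \<le> x\<close>, but the power bound needs \<open>p ^ L \<le> x\<close>; hence one
        surplus factor \<open>(p + 1) / 2\<close>.\<close>
      then obtain L where L': "p ^ L \<le> nat \<lfloor>x\<rfloor>" "nat \<lfloor>x\<rfloor> < p ^ Suc L"
        using ex_power_ivl1[OF p(2)] unfolding Suc_eq_plus1 by blast
      have "real (p ^ L) \<le> real (nat \<lfloor>x\<rfloor>)" using L'(1) by (rule of_nat_mono)
      also have "\<dots> \<le> x" using elim(1) by simp
      finally have L1: "real p ^ L \<le> x" by simp
      have L2: "n < p ^ Suc L" if "real n \<le> x" for n
        using le_nat_floor[OF that] L'(2) by linarith
      note L = L1 L2
      have "2 ^ L \<le> real p ^ L" using p by (intro power_mono) auto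
      hence "2 ^ L \<le> x" using L(1) by linarith
      hence "ln (2 ^ L) \<le> ln x" by (intro ln_mono) auto
      hence "real L * ln 2 \<le> ln x" by (simp add: ln_realpow)
      moreover have "real L * (2 / 3) \<le> real L * ln 2" using ln2_ge_two_thirds by (intro mult_left_mono) auto
      ultimately have LL: "real (Suc L) \<le> 2 * ln x + 1" using elim(1) ln_gt_zero[of x] by simp
      have "(\<Sum>n | real n \<le> x. real (coprime_binomials p n) / real n)
          \<le> (\<Sum>n<p ^ Suc L. real (coprime_binomials p n) / real n)"
        using L(2) by (intro sum_mono2) auto
      also have "\<dots> \<le> 2 * real p * real (Suc L) * ((real p + 1) / 2) ^ Suc L"
        by (rule sum_coprime_binomials[OF p(1)])
      also have "\<dots> = 2 * real p * real (Suc L) * ((real p + 1) / 2) * ((real p + 1) / 2) ^ L" by simp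
      also have "\<dots> \<le> 2 * Y * (2 * ln x + 1) * Y * x powr E"
      proof (intro mult_mono)
        show "((real p + 1) / 2) ^ L \<le> x powr E"
          using elim(4) p L(1) by (auto simp: E_def Y_def)
      qed (use p LL elim(1) in auto)
      finally show ?thesis .
    qed
    have "(\<Sum>n | real n \<le> x. real (nonpractical_binomials n) / real n)
        \<le> (\<Sum>n | real n \<le> x. \<Sum>p\<in>P. real (coprime_binomials p n) / real n)"
    proof (rule sum_mono)
      fix n assume "n \<in> {n. real n \<le> x}"
      hence "n \<le> primorial_below (Suc (2 * m))" using m(2) by simp
      hence "real (nonpractical_binomials n) \<le> real (\<Sum>p\<in>P. coprime_binomials p n)"
        unfolding P_def by (intro of_nat_mono nonpractical_binomials_le)
      thus "real (nonpractical_binomials n) / real n \<le> (\<Sum>p\<in>P. real (coprime_binomials p n) / real n)"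
        by (simp add: divide_right_mono flip: sum_divide_distrib)
    qed
    also have "\<dots> = (\<Sum>p\<in>P. \<Sum>n | real n \<le> x. real (coprime_binomials p n) / real n)"
      by (rule sum.swap)
    also have "\<dots> \<le> (\<Sum>p\<in>P. 2 * Y * (2 * ln x + 1) * Y * x powr E)" by (intro sum_mono bound)
    also have "\<dots> = real (card P) * (2 * Y * (2 * ln x + 1) * Y * x powr E)" by simp
    also have "\<dots> \<le> Y * (2 * Y * (2 * ln x + 1) * Y * x powr E)"
      using cardP elim(1) by (intro mult_right_mono) (auto simp: Y_def)
    also have "\<dots> = Y * (2 * Y * (2 * ln x + 1) * Y) * x powr E" by (simp only: mult.assoc)
    also have "\<dots> \<le> x powr (\<eta> / ln (ln x)) * x powr E"
      using elim(2) by (intro mult_right_mono) (simp_all add: Y_def)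
    also have "\<dots> = x powr (\<eta> / ln (ln x) + E)" by (simp add: powr_add)
    also have "\<eta> / ln (ln x) + E = 1 - (ln 2 - 2 * \<eta>) / ln (ln x)"
      by (simp add: E_def diff_divide_distrib)
    finally show ?case .
  qed
qed

text \<open>Markov's inequality: every exceptional \<open>n \<ge> 64\<close> has
  \<open>f(n) / n * W \<ge> 1\<close>, with one weight \<open>W\<close> for all \<open>n\<close> by
  monotonicity of \<open>u / ln u\<close>. The \<open>n < 64\<close> are counted trivially, and 64
  is absorbed since the power of \<open>x\<close> is at least 1.\<close>

lemma card_exceptional_le:
  fixes x \<gamma> \<delta> :: real
  assumes x: "x \<ge> 64" and d: "\<gamma> < \<delta>" "\<delta> < ln 2" and ll: "ln (ln x) \<ge> 1"
    and sum: "(\<Sum>n | real n \<le> x. real (nonpractical_binomials n) / real n)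
      \<le> x powr (1 - (ln 2 - \<gamma>) / ln (ln x))"
    and g: "\<gamma> > 0"
  shows "real (card {n::nat. 3 \<le> n \<and> real n \<le> x \<and>
      \<not> real (nonpractical_binomials n) < real n powr (1 - (ln 2 - \<delta>) / ln (ln (real n)))})
    \<le> 65 * x powr (1 - (\<delta> - \<gamma>) / ln (ln x))"
proof -
  define S where "S = {n::nat. 3 \<le> n \<and> real n \<le> x \<and>
      \<not> real (nonpractical_binomials n) < real n powr (1 - (ln 2 - \<delta>) / ln (ln (real n)))}"
  define W where "W = x powr ((ln 2 - \<delta>) / ln (ln x))"
  have fin: "finite {n. real n \<le> x}" by (rule finite_subset[of _ "{..nat \<lfloor>x\<rfloor>}"]) (auto simp: le_nat_floor)
  have finS: "finite S" by (rule finite_subset[OF _ fin]) (auto simp: S_def)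
  have big: "1 \<le> real (nonpractical_binomials n) / real n * W" if n: "n \<in> S" "n \<ge> 64" for n
  proof -
    have n0: "real n > 0" "real n \<le> x" using n by (auto simp: S_def)
    have "exp 1 \<le> (3::real)" by (rule exp_le)
    \<comment> \<open>The cutoff \<open>64 = 2 ^ 6\<close> ensures \<open>ln n \<ge> exp 1\<close>,
      where the monotonicity starts.\<close>
    also have "3 \<le> 6 * ln (2::real)" using ln2_ge_two_thirds by simp
    also have "\<dots> = ln (2 ^ 6)" by (simp add: ln_realpow del: power_numeral)
    also have "\<dots> \<le> ln (real n)" using n by (intro ln_mono) auto
    finally have "ln (real n) / ln (ln (real n)) \<le> ln x / ln (ln x)"
      using n0 by (intro ln_div_ln_ln_mono) auto
    hence "(ln 2 - \<delta>) * (ln (real n) / ln (ln (real n))) \<le> (ln 2 - \<delta>) * (ln x / ln (ln x))"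
      using d by (intro mult_left_mono) auto
    hence W: "real n powr ((ln 2 - \<delta>) / ln (ln (real n))) \<le> W"
      using n0 by (simp add: W_def powr_def)
    have "real n / real n powr ((ln 2 - \<delta>) / ln (ln (real n))) \<le> real (nonpractical_binomials n)"
      using n n0 by (simp add: S_def powr_diff)
    hence "real n \<le> real (nonpractical_binomials n) * real n powr ((ln 2 - \<delta>) / ln (ln (real n)))"
      using n0 by (simp add: field_simps)
    also have "\<dots> \<le> real (nonpractical_binomials n) * W" using W by (intro mult_left_mono) auto
    finally show ?thesis using n0 by (simp add: field_simps)
  qed
  have "real (card S) \<le> real (card ({..<64} \<union> (S - {..<64})))"
    using finS by (intro of_nat_mono card_mono) auto
  also have "\<dots> \<le> real (card {..<64::nat} + card (S - {..<64}))"
    by (intro of_nat_mono card_Un_le)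
  also have "\<dots> = 64 + (\<Sum>n\<in>S - {..<64}. 1)" by simp
  also have "(\<Sum>n\<in>S - {..<64}. 1) \<le> (\<Sum>n\<in>S - {..<64}. real (nonpractical_binomials n) / real n * W)"
    using big by (intro sum_mono) auto
  also have "\<dots> \<le> (\<Sum>n | real n \<le> x. real (nonpractical_binomials n) / real n * W)"
    using fin by (intro sum_mono2) (auto simp: S_def W_def)
  also have "\<dots> = (\<Sum>n | real n \<le> x. real (nonpractical_binomials n) / real n) * W"
    by (simp add: sum_distrib_right)
  also have "\<dots> \<le> x powr (1 - (ln 2 - \<gamma>) / ln (ln x)) * W"
    using sum by (intro mult_right_mono) (auto simp: W_def)
  also have "\<dots> = x powr (1 - (ln 2 - \<gamma>) / ln (ln x) + (ln 2 - \<delta>) / ln (ln x))"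
    by (simp only: W_def powr_add)
  also have "1 - (ln 2 - \<gamma>) / ln (ln x) + (ln 2 - \<delta>) / ln (ln x) = 1 - (\<delta> - \<gamma>) / ln (ln x)"
    by (simp add: diff_divide_distrib)
  finally have "real (card S) \<le> 64 + x powr (1 - (\<delta> - \<gamma>) / ln (ln x))" by simp
  moreover have "1 \<le> x powr (1 - (\<delta> - \<gamma>) / ln (ln x))"
  proof (rule ge_one_powr_ge_zero)
    have "\<delta> - \<gamma> \<le> 1" using d g ln_2_less_1 by linarith
    thus "0 \<le> 1 - (\<delta> - \<gamma>) / ln (ln x)" using ll by (simp add: field_simps)
  qed (use x in simp)
  ultimately show ?thesis unfolding S_def by linarith
qed

theorem theorem1p1:
  fixes \<gamma> :: real
  assumes "\<gamma> > 0"
  shows "\<exists>C::real. \<forall>\<delta>::real. \<forall>x::real.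
           \<gamma> < \<delta> \<and> \<delta> < ln 2 \<and> x \<ge> 3 \<longrightarrow>
           real (card {n::nat. 3 \<le> n \<and> real n \<le> x \<and>
               \<not> real (nonpractical_binomials n)
                    < real n powr (1 - (ln 2 - \<delta>) / ln (ln (real n)))})
             \<le> C * x powr (1 - (\<delta> - \<gamma>) / ln (ln x))"
proof (cases "\<gamma> < ln 2")
  case True
  have "eventually (\<lambda>x. (\<Sum>n | real n \<le> x. real (nonpractical_binomials n) / real n)
      \<le> x powr (1 - (ln 2 - 2 * (\<gamma> / 2)) / ln (ln x))) at_top"
    using assms True by (intro eventually_sum_nonpractical_binomials) auto
  moreover have "eventually (\<lambda>x::real. x \<ge> 64) at_top" by (rule eventually_ge_at_top)
  moreover have "eventually (\<lambda>x::real. ln (ln x) \<ge> 1) at_top" by real_asymp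
  ultimately have "eventually (\<lambda>x. x \<ge> 64 \<and> ln (ln x) \<ge> 1 \<and>
      (\<Sum>n | real n \<le> x. real (nonpractical_binomials n) / real n)
        \<le> x powr (1 - (ln 2 - \<gamma>) / ln (ln x))) at_top"
    by eventually_elim simp
  \<comment> \<open>\<open>X\<close> is fixed before \<open>\<delta>\<close> appears, so the
    constant depends on \<open>\<gamma>\<close> only.\<close>
  then obtain X where X: "x \<ge> 64" "ln (ln x) \<ge> 1"
      "(\<Sum>n | real n \<le> x. real (nonpractical_binomials n) / real n)
        \<le> x powr (1 - (ln 2 - \<gamma>) / ln (ln x))" if "x \<ge> X" for x
    by (auto simp: eventually_at_top_linorder)
  \<comment> \<open>For \<open>x \<ge> 3\<close>, \<open>s\<close> bounds
    \<open>(\<delta> - \<gamma>) / ln (ln x)\<close>; hence for \<open>x < X\<close> the trivial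
    count \<open>x\<close> is at most \<open>X powr s\<close> times the target.\<close>
  define s where "s = ln 2 / ln (ln (3::real))"
  define C where "C = 65 + X powr s"
  have ln3: "ln (3::real) > 1" using ln3_gt_1 by simp
  show ?thesis
  proof (intro exI[of _ C] allI impI, elim conjE)
    fix \<delta> x :: real
    assume d: "\<gamma> < \<delta>" "\<delta> < ln 2" and x: "x \<ge> 3"
    define S where "S = {n::nat. 3 \<le> n \<and> real n \<le> x \<and>
      \<not> real (nonpractical_binomials n) < real n powr (1 - (ln 2 - \<delta>) / ln (ln (real n)))}"
    define R where "R = x powr (1 - (\<delta> - \<gamma>) / ln (ln x))"
    have R: "R \<ge> 0" by (simp add: R_def)
    have "real (card S) \<le> C * R"
    proof (cases "x \<ge> X")
      case True
      have "real (card S) \<le> 65 * R"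
        unfolding S_def R_def using X[OF True] d assms by (intro card_exceptional_le) auto
      also have "\<dots> \<le> C * R" using R by (intro mult_right_mono) (auto simp: C_def)
      finally show ?thesis .
    next
      case False
      have "S \<subseteq> {1..nat \<lfloor>x\<rfloor>}" by (auto simp: S_def le_nat_floor)
      hence "card S \<le> card {1..nat \<lfloor>x\<rfloor>}" by (intro card_mono) auto
      hence "real (card S) \<le> real (nat \<lfloor>x\<rfloor>)" by simp
      also have "\<dots> \<le> x" using x by simp
      also have "x = x powr ((\<delta> - \<gamma>) / ln (ln x)) * R"
        using x by (simp add: R_def flip: powr_add)
      also have "\<dots> \<le> C * R"
      proof (rule mult_right_mono[OF _ R])
        have "ln (ln 3) \<le> ln (ln x)" using x ln3 by (intro ln_mono) auto
        moreover have "ln (ln (3::real)) > 0" using ln3 by simp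
        ultimately have "(\<delta> - \<gamma>) / ln (ln x) \<le> s"
          unfolding s_def using d assms by (intro frac_le) auto
        hence "x powr ((\<delta> - \<gamma>) / ln (ln x)) \<le> x powr s" using x by (intro powr_mono) auto
        also have "\<dots> \<le> X powr s"
          using x False ln3 by (intro powr_mono2) (auto simp: s_def)
        finally show "x powr ((\<delta> - \<gamma>) / ln (ln x)) \<le> C" by (simp add: C_def)
      qed
      finally show ?thesis .
    qed
    thus "real (card {n::nat. 3 \<le> n \<and> real n \<le> x \<and>
        \<not> real (nonpractical_binomials n) < real n powr (1 - (ln 2 - \<delta>) / ln (ln (real n)))})
      \<le> C * x powr (1 - (\<delta> - \<gamma>) / ln (ln x))"
      unfolding S_def R_def .
  qed
next
  case False
  \<comment> \<open>No \<open>\<delta>\<close> lies between \<open>\<gamma>\<close> and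
    \<open>ln 2\<close>, so the claim is vacuous.\<close>
  thus ?thesis by (intro exI[of _ 0]) auto
qed

end
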